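(* Let $(g,[\cdot,\cdot],\omega)$ be an $\omega$-Lie superalgebra over a field $\mathbb{K}$ of characteristic zero, let $U$ be a $\mathbb{Z}_2$-graded subspace with $g=[g,g]\oplus U$, and let $\breve g$ (with bracket and bilinear form $\breve\omega$) and $\varphi:\mathrm{QDer}(g)\to\mathrm{End}(\breve g)$ be as defined in the context. Then $$\varphi(\mathrm{QDer}^{\omega}(g))\subseteq\mathrm{Der}^{\omega}(\breve g).$$
   Context: $\mathbb{K}$ is a field of characteristic zero. An $\omega$-Lie superalgebra is a $\mathbb{Z}_2$-graded $\mathbb{K}$-vector space $g=g_{\bar 0}\oplus g_{\bar 1}$ with a bilinear bracket $[\cdot,\cdot]:g\times g\to g$ and a bilinear form $\omega:g\times g\to\mathbb{K}$ such that, for all $\alpha,\beta\in\mathbb{Z}_2$ and all homogeneous $x,y,z\in g$ (with $|x|\in\mathbb{Z}_2$ the degree of $x$): (1) $[g_\alpha,g_\beta]\subseteq g_{\alpha+\beta}$; (2) $[x,y]=-(-1)^{|x||y|}[y,x]$; (3) $(-1)^{|x||y|}[[y,z],x]+(-1)^{|y||z|}[[z,x],y]+(-1)^{|x||z|}[[x,y],z]=(-1)^{|x||y|}\omega(y,z)x+(-1)^{|y||z|}\omega(z,x)y+(-1)^{|x||z|}\omega(x,y)z$; (4) $\omega(g_{\bar 0},g_{\bar 1})=0$. $[g,g]$ is the span of all brackets. Construction of $\breve g$: let $t$ be an indeterminate and $\breve g=g\otimes t\,\mathbb{K}[t]/(t^3)=gt\oplus gt^2$ (write $xt^i$ for $x\otimes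 t^i$), graded by $\breve g_\alpha=g_\alpha t\oplus g_\alpha t^2$, with bracket determined by $[xt,yt]=[x,y]t^2$ and $[xt^i,yt^j]=0$ for all other $i,j\in\{1,2\}$, and bilinear form determined by $\breve\omega(xt,yt)=\omega(x,y)$ and $\breve\omega(xt^i,yt^j)=0$ for all other $i,j\in\{1,2\}$. Maps: let $(A,[\cdot,\cdot],\omega_A)$ be $g$ with $\omega$ or $\breve g$ with $\breve\omega$. All conditions are for homogeneous $x\in A$ and all $y\in A$. A homogeneous linear map $d:A\to A$ of degree $|d|$ is: a derivation if $d([x,y])=[d(x),y]+(-1)^{|d||x|}[x,d(y)]$; a quasiderivation if there is a linear map $d'$ homogeneous of degree $|d|$ with $d'([x,y])=[d(x),y]+(-1)^{|d||x|}[x,d(y)]$; compatible if $\omega_A(d(x),y)+(-1)^{|d||x|}\omega_A(x,d(y))=0$. $\mathrm{QDer}(A)$ is the graded subspace of $\mathrm{End}(A)$ spanned by the homogeneous quasiderivations; $\mathrm{Der}^{\omega}(A)$ and $\mathrm{QDer}^{\omega}(A)$ are the graded subspaces spanned by the compatible homogeneous derivations, respectively compatible homogeneous quasiderivations. The map $\varphi$: one has $\breve g=gt\oplus[g,g]t^2\oplus Ut^2$. For a homogeneous quasiderivation $d$ of $g$ with associated map $d'$ (as in the definition of quasiderivation), $\varphi(d)(at+bt^2+ut^2)=d(a)t+d'(b)t^2$ for $a\in g$, $b\in[g,g]$, $u\in U$; $\varphi$ is extended linearly to $\mathrm{QDer}(g)$. *)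

theory Defs
  imports "HOL-Analysis.Product_Vector" "HOL-Library.Function_Algebras" "HOL-Library.Z2"
begin

text \<open>
  Degrees live in the two-element field \<^typ>\<open>bit\<close> of integers mod 2.  A graded vector space is
  a whole type with scalar multiplication \<open>s\<close> together with a family \<open>G\<close> of subspaces indexed
  by degrees; \<open>G \<alpha>\<close> is the homogeneous component of degree \<open>\<alpha>\<close>.
\<close>

definition sgn_bit :: "bit \<Rightarrow> 'k::ring_1" where
  "sgn_bit \<alpha> = (if \<alpha> = 0 then 1 else - 1)"

definition direct_sum :: "'v::ab_group_add set \<Rightarrow> 'v set \<Rightarrow> 'v set \<Rightarrow> bool" where
  "direct_sum W A B \<longleftrightarrow> W = {a + b | a b. a \<in> A \<and> b \<in> B} \<and> A \<inter> B = {0}"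

locale omega_lie_superalgebra = vector_space s
  for s :: "'k::field_char_0 \<Rightarrow> 'v::ab_group_add \<Rightarrow> 'v" +
  fixes G :: "bit \<Rightarrow> 'v set"
    and br :: "'v \<Rightarrow> 'v \<Rightarrow> 'v"
    and \<omega> :: "'v \<Rightarrow> 'v \<Rightarrow> 'k"
  assumes subspace_G: "module.subspace s (G \<alpha>)"
    and direct_sum_G: "direct_sum UNIV (G 0) (G 1)"
    and linear_br_left: "Vector_Spaces.linear s s (\<lambda>x. br x y)"
    and linear_br_right: "Vector_Spaces.linear s s (\<lambda>y. br x y)"
    and linear_form_left: "Vector_Spaces.linear s (*) (\<lambda>x. \<omega> x y)"
    and linear_form_right: "Vector_Spaces.linear s (*) (\<lambda>y. \<omega> x y)"
    and br_degree: "x \<in> G \<alpha> \<Longrightarrow> y \<in> G \<beta> \<Longrightarrow> br x y \<in> G (\<alpha> + \<beta>)"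
    and br_skew: "x \<in> G \<alpha> \<Longrightarrow> y \<in> G \<beta> \<Longrightarrow> br x y = - s (sgn_bit (\<alpha> * \<beta>)) (br y x)"
    and omega_jacobi: "x \<in> G \<alpha> \<Longrightarrow> y \<in> G \<beta> \<Longrightarrow> z \<in> G \<gamma> \<Longrightarrow>
        s (sgn_bit (\<alpha> * \<beta>)) (br (br y z) x) + s (sgn_bit (\<beta> * \<gamma>)) (br (br z x) y)
          + s (sgn_bit (\<alpha> * \<gamma>)) (br (br x y) z)
      = s (sgn_bit (\<alpha> * \<beta>) * \<omega> y z) x + s (sgn_bit (\<beta> * \<gamma>) * \<omega> z x) y
          + s (sgn_bit (\<alpha> * \<gamma>) * \<omega> x y) z"
    and form_even_odd: "x \<in> G 0 \<Longrightarrow> y \<in> G 1 \<Longrightarrow> \<omega> x y = 0"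

definition derived :: "('k::comm_ring_1 \<Rightarrow> 'v::ab_group_add \<Rightarrow> 'v) \<Rightarrow> ('v \<Rightarrow> 'v \<Rightarrow> 'v) \<Rightarrow> 'v set" where
  "derived s br = module.span s {br x y | x y. True}"

definition graded_subspace :: "('k::comm_ring_1 \<Rightarrow> 'v::ab_group_add \<Rightarrow> 'v) \<Rightarrow> (bit \<Rightarrow> 'v set) \<Rightarrow> 'v set \<Rightarrow> bool" where
  "graded_subspace s G U \<longleftrightarrow> module.subspace s U \<and> direct_sum U (U \<inter> G 0) (U \<inter> G 1)"

section \<open>Homogeneous maps, derivations, quasiderivations\<close>

text \<open>
  The following notions only need a graded vector space with a bracket and a form, so that they apply
  both to an \<open>\<omega>\<close>-Lie superalgebra and to the construction below, which is not one in general.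
\<close>

definition homogeneous_map ::
  "('k::field \<Rightarrow> 'v::ab_group_add \<Rightarrow> 'v) \<Rightarrow> (bit \<Rightarrow> 'v set) \<Rightarrow> bit \<Rightarrow> ('v \<Rightarrow> 'v) \<Rightarrow> bool" where
  "homogeneous_map s G \<delta> d \<longleftrightarrow> Vector_Spaces.linear s s d \<and> (\<forall>\<alpha>. d ` G \<alpha> \<subseteq> G (\<delta> + \<alpha>))"

definition derivation ::
  "('k::field \<Rightarrow> 'v::ab_group_add \<Rightarrow> 'v) \<Rightarrow> (bit \<Rightarrow> 'v set) \<Rightarrow> ('v \<Rightarrow> 'v \<Rightarrow> 'v) \<Rightarrow> bit \<Rightarrow> ('v \<Rightarrow> 'v) \<Rightarrow> bool" where
  "derivation s G br \<delta> d \<longleftrightarrow> homogeneous_map s G \<delta> d \<and>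
     (\<forall>\<alpha>. \<forall>x\<in>G \<alpha>. \<forall>y. d (br x y) = br (d x) y + s (sgn_bit (\<delta> * \<alpha>)) (br x (d y)))"

text \<open>\<open>d'\<close> is a map associated to the quasiderivation \<open>d\<close> of degree \<open>\<delta>\<close>.\<close>

definition quasi_associated ::
  "('k::field \<Rightarrow> 'v::ab_group_add \<Rightarrow> 'v) \<Rightarrow> (bit \<Rightarrow> 'v set) \<Rightarrow> ('v \<Rightarrow> 'v \<Rightarrow> 'v) \<Rightarrow> bit
    \<Rightarrow> ('v \<Rightarrow> 'v) \<Rightarrow> ('v \<Rightarrow> 'v) \<Rightarrow> bool" where
  "quasi_associated s G br \<delta> d d' \<longleftrightarrow> homogeneous_map s G \<delta> d \<and> homogeneous_map s G \<delta> d' \<and>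
     (\<forall>\<alpha>. \<forall>x\<in>G \<alpha>. \<forall>y. d' (br x y) = br (d x) y + s (sgn_bit (\<delta> * \<alpha>)) (br x (d y)))"

definition quasiderivation ::
  "('k::field \<Rightarrow> 'v::ab_group_add \<Rightarrow> 'v) \<Rightarrow> (bit \<Rightarrow> 'v set) \<Rightarrow> ('v \<Rightarrow> 'v \<Rightarrow> 'v) \<Rightarrow> bit \<Rightarrow> ('v \<Rightarrow> 'v) \<Rightarrow> bool" where
  "quasiderivation s G br \<delta> d \<longleftrightarrow> (\<exists>d'. quasi_associated s G br \<delta> d d')"

definition compatible ::
  "(bit \<Rightarrow> 'v set) \<Rightarrow> ('v \<Rightarrow> 'v \<Rightarrow> 'k::field) \<Rightarrow> bit \<Rightarrow> ('v \<Rightarrow> 'v) \<Rightarrow> bool" where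
  "compatible G \<omega> \<delta> d \<longleftrightarrow>
     (\<forall>\<alpha>. \<forall>x\<in>G \<alpha>. \<forall>y. \<omega> (d x) y + sgn_bit (\<delta> * \<alpha>) * \<omega> x (d y) = 0)"

definition End_span :: "('k::field \<Rightarrow> 'v::ab_group_add \<Rightarrow> 'v) \<Rightarrow> ('v \<Rightarrow> 'v) set \<Rightarrow> ('v \<Rightarrow> 'v) set" where
  "End_span s = module.span (\<lambda>c f x. s c (f x))"

definition QDer ::
  "('k::field \<Rightarrow> 'v::ab_group_add \<Rightarrow> 'v) \<Rightarrow> (bit \<Rightarrow> 'v set) \<Rightarrow> ('v \<Rightarrow> 'v \<Rightarrow> 'v) \<Rightarrow> ('v \<Rightarrow> 'v) set" where
  "QDer s G br = End_span s {d. \<exists>\<delta>. quasiderivation s G br \<delta> d}"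

definition Der_omega ::
  "('k::field \<Rightarrow> 'v::ab_group_add \<Rightarrow> 'v) \<Rightarrow> (bit \<Rightarrow> 'v set) \<Rightarrow> ('v \<Rightarrow> 'v \<Rightarrow> 'v) \<Rightarrow> ('v \<Rightarrow> 'v \<Rightarrow> 'k)
    \<Rightarrow> ('v \<Rightarrow> 'v) set" where
  "Der_omega s G br \<omega> = End_span s {d. \<exists>\<delta>. derivation s G br \<delta> d \<and> compatible G \<omega> \<delta> d}"

definition QDer_omega ::
  "('k::field \<Rightarrow> 'v::ab_group_add \<Rightarrow> 'v) \<Rightarrow> (bit \<Rightarrow> 'v set) \<Rightarrow> ('v \<Rightarrow> 'v \<Rightarrow> 'v) \<Rightarrow> ('v \<Rightarrow> 'v \<Rightarrow> 'k)
    \<Rightarrow> ('v \<Rightarrow> 'v) set" where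
  "QDer_omega s G br \<omega> = End_span s {d. \<exists>\<delta>. quasiderivation s G br \<delta> d \<and> compatible G \<omega> \<delta> d}"

section \<open>The extension of g by t and t squared\<close>

text \<open>
  Since \<open>t, t\<^sup>2\<close> is a basis of \<open>t\<bbbK>[t]/(t\<^sup>3)\<close>, the tensor product \<open>g \<otimes> t\<bbbK>[t]/(t\<^sup>3)\<close> is
  \<open>g t \<oplus> g t\<^sup>2\<close>; the pair \<open>(x, x')\<close> stands for \<open>x t + x' t\<^sup>2\<close>.
\<close>

definition breve_scale :: "('k::comm_ring_1 \<Rightarrow> 'v::ab_group_add \<Rightarrow> 'v) \<Rightarrow> 'k \<Rightarrow> 'v \<times> 'v \<Rightarrow> 'v \<times> 'v" where
  "breve_scale s = module_prod.scale s s"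

definition breve_grading :: "(bit \<Rightarrow> 'v set) \<Rightarrow> bit \<Rightarrow> ('v \<times> 'v) set" where
  "breve_grading G \<alpha> = G \<alpha> \<times> G \<alpha>"

fun breve_br :: "('v \<Rightarrow> 'v \<Rightarrow> 'v::ab_group_add) \<Rightarrow> 'v \<times> 'v \<Rightarrow> 'v \<times> 'v \<Rightarrow> 'v \<times> 'v" where
  "breve_br br (x, x') (y, y') = (0, br x y)"

fun breve_form :: "('v \<Rightarrow> 'v \<Rightarrow> 'k) \<Rightarrow> 'v \<times> 'v \<Rightarrow> 'v \<times> 'v \<Rightarrow> 'k" where
  "breve_form \<omega> (x, x') (y, y') = \<omega> x y"

section \<open>The map phi\<close>

text \<open>The component in \<open>A\<close> of an element of the direct sum of \<open>A\<close> and \<open>B\<close>.\<close>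

definition proj_along :: "'v::ab_group_add set \<Rightarrow> 'v set \<Rightarrow> 'v \<Rightarrow> 'v" where
  "proj_along A B x = (THE a. a \<in> A \<and> x - a \<in> B)"

definition component :: "(bit \<Rightarrow> 'v::ab_group_add set) \<Rightarrow> bit \<Rightarrow> 'v \<Rightarrow> 'v" where
  "component G \<alpha> = proj_along (G \<alpha>) (G (\<alpha> + 1))"

text \<open>The homogeneous part of degree \<open>\<delta>\<close> of an endomorphism.\<close>

definition map_part :: "(bit \<Rightarrow> 'v::ab_group_add set) \<Rightarrow> bit \<Rightarrow> ('v \<Rightarrow> 'v) \<Rightarrow> 'v \<Rightarrow> 'v" where
  "map_part G \<delta> d x = component G \<delta> (d (component G 0 x)) + component G (\<delta> + 1) (d (component G 1 x))"

text \<open>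
  The associated map \<open>d'\<close> is not unique, but its restriction to \<open>[g,g]\<close> is, so the choice made here
  is harmless.  An element of \<open>QDer\<close> is the sum of its two homogeneous parts, which are themselves
  quasiderivations; this gives the linear extension.  The lemmas \<open>phi_quasiderivation\<close>,
  \<open>phi_add\<close> and \<open>phi_scale\<close> below state that \<open>phi\<close> is the map with the characterizing
  properties.  Its values outside \<open>QDer\<close> are meaningless.
\<close>

definition phi_hom ::
  "('k::field \<Rightarrow> 'v::ab_group_add \<Rightarrow> 'v) \<Rightarrow> (bit \<Rightarrow> 'v set) \<Rightarrow> ('v \<Rightarrow> 'v \<Rightarrow> 'v) \<Rightarrow> 'v set
    \<Rightarrow> bit \<Rightarrow> ('v \<Rightarrow> 'v) \<Rightarrow> 'v \<times> 'v \<Rightarrow> 'v \<times> 'v" where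
  "phi_hom s G br U \<delta> d = (\<lambda>(x, x').
     (d x, (SOME d'. quasi_associated s G br \<delta> d d') (proj_along (derived s br) U x')))"

definition phi ::
  "('k::field \<Rightarrow> 'v::ab_group_add \<Rightarrow> 'v) \<Rightarrow> (bit \<Rightarrow> 'v set) \<Rightarrow> ('v \<Rightarrow> 'v \<Rightarrow> 'v) \<Rightarrow> 'v set
    \<Rightarrow> ('v \<Rightarrow> 'v) \<Rightarrow> 'v \<times> 'v \<Rightarrow> 'v \<times> 'v" where
  "phi s G br U d v = phi_hom s G br U 0 (map_part G 0 d) v + phi_hom s G br U 1 (map_part G 1 d) v"

lemma proj_alongI:
  assumes "module s" "module.subspace s A" "module.subspace s B" "A \<inter> B = {0}" "a \<in> A" "b \<in> B"
  shows "proj_along A B (a + b) = a"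
  unfolding proj_along_def
proof (rule the_equality)
  interpret module s by fact
  show "a \<in> A \<and> a + b - a \<in> B" using assms by simp
  fix c assume c: "c \<in> A \<and> a + b - c \<in> B"
  then have "a - c \<in> A" using assms subspace_diff by blast
  moreover have "(a + b - c) - b \<in> B" using assms c subspace_diff by blast
  then have "a - c \<in> B" by (simp add: algebra_simps)
  ultimately have "a - c = 0" using assms by blast
  then show "c = a" by simp
qed

context omega_lie_superalgebra
begin

lemma component_sum:
  assumes "a \<in> G \<alpha>" "b \<in> G (\<alpha> + 1)"
  shows "component G \<alpha> (a + b) = a"
proof -
  have "G \<alpha> \<inter> G (\<alpha> + 1) = {0}"
    using direct_sum_G by (cases \<alpha>) (auto simp: direct_sum_def)
  then show ?thesis
    unfolding component_def
    using proj_alongI[OF module_axioms subspace_G subspace_G] assms by blast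
qed

lemma decompose: obtains a b where "a \<in> G 0" "b \<in> G 1" "x = a + b"
  using direct_sum_G unfolding direct_sum_def by blast

lemma decompose': obtains a b where "a \<in> G \<alpha>" "b \<in> G (\<alpha> + 1)" "x = a + b"
proof (cases "\<alpha> = 0")
  case True then show ?thesis using that decompose[of x] by auto
next
  case False
  obtain a b where "a \<in> G 0" "b \<in> G 1" "x = a + b" by (rule decompose)
  then show ?thesis using that[of b a] False by (simp add: add.commute)
qed

lemma zero_in_G [simp]: "0 \<in> G \<alpha>"
  using subspace_G subspace_0 by blast

lemma component_same [simp]: "a \<in> G \<alpha> \<Longrightarrow> component G \<alpha> a = a"
  using component_sum[of a \<alpha> 0] by simp

lemma component_other [simp]: "b \<in> G (\<alpha> + 1) \<Longrightarrow> component G \<alpha> b = 0"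
  using component_sum[of 0 \<alpha> b] by simp

lemma component_in [simp]: "component G \<alpha> x \<in> G \<alpha>"
  by (rule decompose'[of \<alpha> x]) (simp add: component_sum)

lemma component_add: "component G \<alpha> (x + y) = component G \<alpha> x + component G \<alpha> y"
proof -
  obtain a b where x: "a \<in> G \<alpha>" "b \<in> G (\<alpha> + 1)" "x = a + b" by (rule decompose')
  obtain c e where y: "c \<in> G \<alpha>" "e \<in> G (\<alpha> + 1)" "y = c + e" by (rule decompose')
  have "component G \<alpha> ((a + c) + (b + e)) = a + c"
    using x y subspace_G subspace_add by (intro component_sum) blast+
  then show ?thesis using x y by (simp add: component_sum ac_simps)
qed

lemma component_scale: "component G \<alpha> (s k x) = s k (component G \<alpha> x)"
proof -
  obtain a b where x: "a \<in> G \<alpha>" "b \<in> G (\<alpha> + 1)" "x = a + b" by (rule decompose')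
  have "component G \<alpha> (s k a + s k b) = s k a"
    using x subspace_G subspace_scale by (intro component_sum) blast+
  then show ?thesis using x by (simp add: component_sum scale_right_distrib)
qed

lemma component_0_plus_1: "component G 0 x + component G 1 x = x"
proof -
  obtain a b where x: "a \<in> G 0" "b \<in> G 1" "x = a + b" by (rule decompose)
  then show ?thesis using component_sum[of a 0 b] component_sum[of b 1 a] by (simp add: add.commute)
qed

lemma map_part_same:
  assumes "homogeneous_map s G \<delta> d"
  shows "map_part G \<delta> d = d"
proof
  fix x
  interpret d: Vector_Spaces.linear s s d using assms by (simp add: homogeneous_map_def)
  have "d (component G 0 x) \<in> G (\<delta> + 0)" "d (component G 1 x) \<in> G (\<delta> + 1)"
    using assms component_in unfolding homogeneous_map_def by blast+
  then have "component G \<delta> (d (component G 0 x)) = d (component G 0 x)"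
      "component G (\<delta> + 1) (d (component G 1 x)) = d (component G 1 x)"
    using component_same[of _ "\<delta> + 0"] component_same[of _ "\<delta> + 1"] by (auto simp only: add_0_right)
  then show "map_part G \<delta> d x = d x"
    using component_0_plus_1[of x] by (simp only: map_part_def flip: d.add)
qed

lemma map_part_other:
  assumes "homogeneous_map s G \<delta> d"
  shows "map_part G (\<delta> + 1) d = 0"
proof
  fix x
  have "d (component G 0 x) \<in> G (\<delta> + 0)" "d (component G 1 x) \<in> G (\<delta> + 1)"
    using assms component_in unfolding homogeneous_map_def by blast+
  moreover have "\<delta> + 1 + 1 = \<delta>" by (cases \<delta>) auto
  ultimately show "map_part G (\<delta> + 1) d x = 0 x"
    using component_other[of "d (component G 0 x)" "\<delta> + 1"] component_other[of "d (component G 1 x)" "\<delta>"]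
    by (simp add: map_part_def)
qed

lemma linear_add_fun:
  "Vector_Spaces.linear s s d \<Longrightarrow> Vector_Spaces.linear s s e \<Longrightarrow> Vector_Spaces.linear s s (d + e)"
  by (simp add: module_hom_iff plus_fun_def scale_right_distrib add_ac flip: module_hom_eq_linear)

lemma linear_scale_fun:
  "Vector_Spaces.linear s s d \<Longrightarrow> Vector_Spaces.linear s s (\<lambda>x. s k (d x))"
  by (simp add: module_hom_iff scale_right_distrib mult.commute flip: module_hom_eq_linear)

lemma homogeneous_map_add:
  "homogeneous_map s G \<delta> d \<Longrightarrow> homogeneous_map s G \<delta> e \<Longrightarrow> homogeneous_map s G \<delta> (d + e)"
  unfolding homogeneous_map_def
  using linear_add_fun subspace_add[OF subspace_G] by (fastforce simp: image_subset_iff)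

lemma homogeneous_map_scale:
  "homogeneous_map s G \<delta> d \<Longrightarrow> homogeneous_map s G \<delta> (\<lambda>x. s k (d x))"
  unfolding homogeneous_map_def
  using linear_scale_fun subspace_scale[OF subspace_G] by (fastforce simp: image_subset_iff)

lemma br_add_left: "br (x + x') y = br x y + br x' y"
  and br_scale_left: "br (s k x) y = s k (br x y)"
  and br_add_right: "br x (y + y') = br x y + br x y'"
  and br_scale_right: "br x (s k y) = s k (br x y)"
  using linear_br_left[of y] linear_br_right[of x]
  by (simp_all add: module_hom_iff flip: module_hom_eq_linear)

lemma quasi_associated_add:
  assumes "quasi_associated s G br \<delta> d d'" "quasi_associated s G br \<delta> e e'"
  shows "quasi_associated s G br \<delta> (d + e) (d' + e')"
  using assms unfolding quasi_associated_def
  by (auto simp: homogeneous_map_add br_add_left br_add_right scale_right_distrib add_ac)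

lemma quasi_associated_scale:
  assumes "quasi_associated s G br \<delta> d d'"
  shows "quasi_associated s G br \<delta> (\<lambda>x. s k (d x)) (\<lambda>x. s k (d' x))"
  using assms unfolding quasi_associated_def
  by (auto simp: homogeneous_map_scale br_scale_left br_scale_right scale_right_distrib mult.commute)

lemma quasi_associated_zero: "quasi_associated s G br \<delta> 0 0"
proof -
  have "homogeneous_map s G \<delta> 0"
    by (auto simp: homogeneous_map_def module_hom_iff module_axioms simp flip: module_hom_eq_linear)
  moreover have "br 0 y = 0" "br x 0 = 0" for x y
    using br_scale_left[of 0 0 y] br_scale_right[of x 0 0] by simp_all
  ultimately show ?thesis by (simp add: quasi_associated_def)
qed

lemma subspace_derived: "subspace (derived s br)"
  by (simp add: derived_def)

lemma quasi_associated_unique: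
  assumes "quasi_associated s G br \<delta> d d'" "quasi_associated s G br \<delta> d d''" "b \<in> derived s br"
  shows "d' b = d'' b"
proof -
  interpret d': Vector_Spaces.linear s s d'
    using assms by (simp add: homogeneous_map_def quasi_associated_def)
  interpret d'': Vector_Spaces.linear s s d''
    using assms by (simp add: homogeneous_map_def quasi_associated_def)
  have h: "d' (br x y) = d'' (br x y)" if "x \<in> G \<alpha>" for x y \<alpha>
    using assms that by (simp add: quasi_associated_def)
  have "d' (br x y) = d'' (br x y)" for x y
    using h[of "component G 0 x" 0 y] h[of "component G 1 x" 1 y]
      br_add_left[of "component G 0 x" "component G 1 x" y]
    by (simp add: component_0_plus_1 d'.add d''.add)
  note h = this
  have "b \<in> span {br x y | x y. True}"
    using assms by (simp add: derived_def)
  then show ?thesis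
    by (induction rule: span_induct_alt) (auto simp: h d'.add d''.add d'.scale d''.scale d'.zero d''.zero)
qed

lemma some_quasi_associated:
  assumes "quasi_associated s G br \<delta> d d'" "b \<in> derived s br"
  shows "(SOME d'. quasi_associated s G br \<delta> d d') b = d' b"
  by (rule quasi_associated_unique[OF _ assms]) (rule someI[of "quasi_associated s G br \<delta> d", OF assms(1)])

lemma phi_hom_eq:
  assumes "subspace U" "direct_sum UNIV (derived s br) U"
    and "quasi_associated s G br \<delta> d d'" "b \<in> derived s br" "u \<in> U"
  shows "phi_hom s G br U \<delta> d (a, b + u) = (d a, d' b)"
proof -
  have "proj_along (derived s br) U (b + u) = b"
    using proj_alongI[OF module_axioms subspace_derived assms(1)] assms
    by (auto simp: direct_sum_def)
  then show ?thesis using some_quasi_associated assms by (simp add: phi_hom_def)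
qed

text \<open>The defining property of \<open>phi\<close> on homogeneous quasiderivations, for any choice of \<open>d'\<close>.\<close>

lemma phi_quasiderivation:
  assumes "subspace U" "direct_sum UNIV (derived s br) U"
    and "quasi_associated s G br \<delta> d d'" "b \<in> derived s br" "u \<in> U"
  shows "phi s G br U d (a, b + u) = (d a, d' b)"
proof -
  have d: "homogeneous_map s G \<delta> d" using assms by (simp add: quasi_associated_def)
  have 1: "phi_hom s G br U \<delta> (map_part G \<delta> d) (a, b + u) = (d a, d' b)"
    using phi_hom_eq[OF assms] map_part_same[OF d] by simp
  have 2: "phi_hom s G br U (\<delta> + 1) (map_part G (\<delta> + 1) d) (a, b + u) = 0"
    using phi_hom_eq[OF assms(1,2) quasi_associated_zero assms(4,5)] map_part_other[OF d]
    by (simp add: zero_prod_def)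
  show ?thesis using 1 2 by (cases \<delta>) (auto simp: phi_def)
qed

lemma module_fun: "module (\<lambda>c f x. s c (f x))"
  by unfold_locales (auto simp: fun_eq_iff scale_right_distrib scale_left_distrib)

lemma map_part_add: 
  assumes "Vector_Spaces.linear s s d" "Vector_Spaces.linear s s e"
  shows "map_part G \<delta> (d + e) = map_part G \<delta> d + map_part G \<delta> e"
  by (auto simp: map_part_def component_add ac_simps)

lemma map_part_scale: "map_part G \<delta> (\<lambda>x. s k (d x)) = (\<lambda>x. s k (map_part G \<delta> d x))"
  by (auto simp: map_part_def component_scale scale_right_distrib)

lemma QDer_part:
  assumes "d \<in> QDer s G br"
  shows "Vector_Spaces.linear s s d \<and> (\<forall>\<delta>. quasiderivation s G br \<delta> (map_part G \<delta> d))"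
proof -
  interpret F: module "\<lambda>c f x. s c (f x)" by (rule module_fun)
  have "d \<in> F.span {d. \<exists>\<delta>. quasiderivation s G br \<delta> d}"
    using assms by (simp add: QDer_def End_span_def)
  then show ?thesis
  proof (induction rule: F.span_induct_alt)
    case base
    have "Vector_Spaces.linear s s 0" "map_part G \<delta> 0 = 0" for \<delta>
      using quasi_associated_zero by (auto simp: quasi_associated_def homogeneous_map_def map_part_def)
    then show ?case using quasi_associated_zero
      by (auto simp: quasiderivation_def simp flip: zero_fun_def)
  next
    case (step c f e)
    then obtain \<epsilon> where f: "quasiderivation s G br \<epsilon> f" by blast
    then have hf: "homogeneous_map s G \<epsilon> f" by (auto simp: quasiderivation_def quasi_associated_def)
    have "quasiderivation s G br \<delta> (map_part G \<delta> f)" for \<delta>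
    proof (cases "\<delta> = \<epsilon>")
      case True then show ?thesis using f map_part_same[OF hf] by simp
    next
      case False
      then have "\<delta> = \<epsilon> + 1" by (cases \<delta>; cases \<epsilon>) auto
      then show ?thesis using map_part_other[OF hf] quasi_associated_zero by (auto simp: quasiderivation_def)
    qed
    then have "quasiderivation s G br \<delta> (\<lambda>x. s c (map_part G \<delta> f x))" for \<delta>
      using quasi_associated_scale unfolding quasiderivation_def by blast
    then have "quasiderivation s G br \<delta> ((\<lambda>x. s c (map_part G \<delta> f x)) + map_part G \<delta> e)" for \<delta>
      using step.IH quasi_associated_add unfolding quasiderivation_def by blast
    moreover have l: "Vector_Spaces.linear s s (\<lambda>x. s c (f x))"
      using hf linear_scale_fun by (auto simp: homogeneous_map_def)
    ultimately show ?case
      using step.IH linear_add_fun[OF l] by (simp only: map_part_add map_part_scale) blast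
  qed
qed

lemma phi_add:
  assumes "subspace U" "direct_sum UNIV (derived s br) U" "d \<in> QDer s G br" "e \<in> QDer s G br"
  shows "phi s G br U (d + e) = phi s G br U d + phi s G br U e"
proof
  fix v :: "'v \<times> 'v"
  obtain a b u where v: "v = (a, b + u)" "b \<in> derived s br" "u \<in> U"
    using assms(2) unfolding direct_sum_def by (cases v) blast
  have "phi_hom s G br U \<delta> (map_part G \<delta> (d + e)) v
      = phi_hom s G br U \<delta> (map_part G \<delta> d) v + phi_hom s G br U \<delta> (map_part G \<delta> e) v" for \<delta>
  proof -
    obtain d' e' where h: "quasi_associated s G br \<delta> (map_part G \<delta> d) d'"
        "quasi_associated s G br \<delta> (map_part G \<delta> e) e'"
      using QDer_part assms unfolding quasiderivation_def by blast
    show ?thesis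
      using phi_hom_eq[OF assms(1,2) h(1) v(2,3)] phi_hom_eq[OF assms(1,2) h(2) v(2,3)]
        phi_hom_eq[OF assms(1,2) quasi_associated_add[OF h] v(2,3)] v(1) QDer_part assms map_part_add
      by simp
  qed
  then show "phi s G br U (d + e) v = (phi s G br U d + phi s G br U e) v"
    by (simp add: phi_def ac_simps)
qed

lemma phi_scale:
  assumes "subspace U" "direct_sum UNIV (derived s br) U" "d \<in> QDer s G br"
  shows "phi s G br U (\<lambda>x. s k (d x)) = (\<lambda>v. breve_scale s k (phi s G br U d v))"
proof
  fix v :: "'v \<times> 'v"
  interpret p: module_prod s s by unfold_locales
  obtain a b u where v: "v = (a, b + u)" "b \<in> derived s br" "u \<in> U"
    using assms(2) unfolding direct_sum_def by (cases v) blast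
  have "phi_hom s G br U \<delta> (map_part G \<delta> (\<lambda>x. s k (d x))) v
      = breve_scale s k (phi_hom s G br U \<delta> (map_part G \<delta> d) v)" for \<delta>
  proof -
    obtain d' where h: "quasi_associated s G br \<delta> (map_part G \<delta> d) d'"
      using QDer_part assms unfolding quasiderivation_def by blast
    show ?thesis
      using phi_hom_eq[OF assms(1,2) h v(2,3)] 
        phi_hom_eq[OF assms(1,2) quasi_associated_scale[OF h] v(2,3)] v(1)
      by (simp add: map_part_scale breve_scale_def p.scale_prod)
  qed
  then show "phi s G br U (\<lambda>x. s k (d x)) v = breve_scale s k (phi s G br U d v)"
    by (simp add: phi_def breve_scale_def p.p.scale_right_distrib)
qed

end

end

theory Submission
  imports Defs
begin

text \<open>
  The bracket of the extension takes values in \<open>[g,g]t\<^sup>2\<close> and depends only on \<open>t\<close>-components, so the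
  quasiderivation identity of \<open>(d, d')\<close> is exactly the derivation identity of \<open>\<phi>(d)\<close>.  The grading
  of \<open>U\<close> enters only to make the projection onto \<open>[g,g]\<close> along \<open>U\<close> an even map, so that
  \<open>\<phi>(d)\<close> is homogeneous.
\<close>

context omega_lie_superalgebra
begin

lemma breve_scale_Pair [simp]: "breve_scale s k (x, y) = (s k x, s k y)"
proof -
  interpret p: module_prod s s by unfold_locales
  show ?thesis by (simp add: breve_scale_def p.scale_prod)
qed

lemma vector_space_breve_scale: "vector_space (breve_scale s)"
  by unfold_locales (auto simp: scale_right_distrib scale_left_distrib)

text \<open>Bilinearity splits the bracket into four products of homogeneous components; the two
  shown here have degree \<alpha>, the other two have degree \<alpha> + 1. This prepares the proof
  that \<open>[g,g]\<close> is graded.\<close>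

lemma component_br:
  "component G \<alpha> (br x y)
    = br (component G 0 x) (component G \<alpha> y) + br (component G 1 x) (component G (\<alpha> + 1) y)"
proof -
  let ?x = "\<lambda>\<beta>. component G \<beta> x" and ?y = "\<lambda>\<beta>. component G \<beta> y"
  have y: "?y \<alpha> + ?y (\<alpha> + 1) = y"
    using component_0_plus_1[of y] by (cases \<alpha>) (auto simp: add.commute)
  \<comment> \<open>Arithmetic mod 2: the product of the components of degrees 1 and \<alpha> + 1
    falls back into degree \<alpha>.\<close>
  have "1 + (\<alpha> + 1) = \<alpha>"
    by (cases \<alpha>) auto
  then have \<alpha>: "br (?x 0) (?y \<alpha>) + br (?x 1) (?y (\<alpha> + 1)) \<in> G \<alpha>"
    using br_degree[of "?x 0" 0 "?y \<alpha>" \<alpha>] br_degree[of "?x 1" 1 "?y (\<alpha> + 1)" "\<alpha> + 1"]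
    by (auto intro: subspace_add[OF subspace_G])
  have \<alpha>1: "br (?x 0) (?y (\<alpha> + 1)) + br (?x 1) (?y \<alpha>) \<in> G (\<alpha> + 1)"
    using br_degree[of "?x 0" 0 "?y (\<alpha> + 1)" "\<alpha> + 1"] br_degree[of "?x 1" 1 "?y \<alpha>" \<alpha>]
    by (auto intro: subspace_add[OF subspace_G] simp: add.commute)
  have "br x y = br (?x 0 + ?x 1) (?y \<alpha> + ?y (\<alpha> + 1))"
    by (simp only: y component_0_plus_1)
  also have "\<dots> = (br (?x 0) (?y \<alpha>) + br (?x 1) (?y (\<alpha> + 1)))
      + (br (?x 0) (?y (\<alpha> + 1)) + br (?x 1) (?y \<alpha>))"
    by (simp only: br_add_left br_add_right ac_simps)
  finally show ?thesis
    using component_sum[OF \<alpha> \<alpha>1] by simp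
qed

lemma br_in_derived: "br x y \<in> derived s br"
  unfolding derived_def by (rule span_base) blast

text \<open>By \<open>component_br\<close>, a component of a bracket is a sum of two brackets;
  linearity of components extends this to the span.\<close>

lemma component_derived:
  assumes "b \<in> derived s br"
  shows "component G \<alpha> b \<in> derived s br"
proof -
  have "b \<in> span {br x y | x y. True}"
    using assms by (simp add: derived_def)
  then show ?thesis
  proof (induction rule: span_induct_alt)
    case base
    then show ?case using subspace_0[OF subspace_derived] by simp
  next
    case (step c x y)
    then show ?case
      by (auto simp: component_add component_scale component_br
          intro!: subspace_add[OF subspace_derived] subspace_scale[OF subspace_derived] br_in_derived)
  qed
qed

lemma component_graded_subspace:
  assumes "graded_subspace s G U" "u \<in> U"
  shows "component G \<alpha> u \<in> U"
proof -
  obtain a b where "a \<in> U \<inter> G 0" "b \<in> U \<inter> G 1" "u = a + b"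
    using assms unfolding graded_subspace_def direct_sum_def by blast
  then show ?thesis
    using component_sum[of a 0 b] component_sum[of b 1 a]
    by (cases \<alpha>) (auto simp: add.commute)
qed

text \<open>Take the degree \<alpha> components in any decomposition \<open>x = b + u\<close>: both
  summands stay in place because \<open>[g,g]\<close> and \<open>U\<close> are graded. The degree is
  recorded for \<open>b\<close>, the part to which \<open>d'\<close> will be applied.\<close>

lemma homogeneous_decomposition:
  assumes "graded_subspace s G U" "direct_sum UNIV (derived s br) U" "x \<in> G \<alpha>"
  obtains b u where "b \<in> derived s br" "b \<in> G \<alpha>" "u \<in> U" "x = b + u"
proof -
  obtain b u where bu: "b \<in> derived s br" "u \<in> U" "x = b + u"
    using assms(2) unfolding direct_sum_def by blast
  have "x = component G \<alpha> b + component G \<alpha> u"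
    using assms(3) bu(3) component_add component_same by metis
  then show thesis
    using that component_derived[OF bu(1)] component_graded_subspace[OF assms(1) bu(2)] component_in
    by blast
qed

context
  fixes U \<delta> d d'
  assumes graded_U: "graded_subspace s G U"
    and complement_U: "direct_sum UNIV (derived s br) U"
    and quasi: "quasi_associated s G br \<delta> d d'"
begin

private lemma subspace_U: "subspace U"
  using graded_U by (simp add: graded_subspace_def)

text \<open>All associated maps of \<open>d\<close> agree on \<open>[g,g]\<close>, so the fixed
  \<open>d'\<close> can replace the one chosen inside \<open>phi\<close>.\<close>

private lemma phi_eq:
  "b \<in> derived s br \<Longrightarrow> u \<in> U \<Longrightarrow> phi s G br U d (a, b + u) = (d a, d' b)"
  by (rule phi_quasiderivation[OF subspace_U complement_U quasi])

private lemma linear_d: "Vector_Spaces.linear s s d" and linear_d': "Vector_Spaces.linear s s d'"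
  using quasi by (simp_all add: quasi_associated_def homogeneous_map_def)

lemma linear_phi: "Vector_Spaces.linear (breve_scale s) (breve_scale s) (phi s G br U d)"
proof -
  interpret d: Vector_Spaces.linear s s d by (rule linear_d)
  interpret d': Vector_Spaces.linear s s d' by (rule linear_d')
  interpret B: vector_space "breve_scale s" by (rule vector_space_breve_scale)
  have "phi s G br U d (v + w) = phi s G br U d v + phi s G br U d w" for v w
  proof -
    obtain a b u where v: "v = (a, b + u)" "b \<in> derived s br" "u \<in> U"
      using complement_U unfolding direct_sum_def by (cases v) blast
    obtain a' b' u' where w: "w = (a', b' + u')" "b' \<in> derived s br" "u' \<in> U"
      using complement_U unfolding direct_sum_def by (cases w) blast
    \<comment> \<open>Regrouping exhibits the second coordinate as a sum from \<open>[g,g]\<close>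
      and \<open>U\<close> again, so that \<open>phi_eq\<close> applies to
      \<open>v + w\<close>.\<close>
    have "v + w = (a + a', (b + b') + (u + u'))"
      by (simp add: v w ac_simps)
    then have "phi s G br U d (v + w) = (d (a + a'), d' (b + b'))"
      using phi_eq[OF subspace_add[OF subspace_derived v(2) w(2)] subspace_add[OF subspace_U v(3) w(3)]]
      by simp
    then show ?thesis
      using phi_eq[OF v(2,3)] phi_eq[OF w(2,3)] v(1) w(1)
      by (simp add: d.add d'.add)
  qed
  moreover have "phi s G br U d (breve_scale s k v) = breve_scale s k (phi s G br U d v)" for k v
  proof -
    obtain a b u where v: "v = (a, b + u)" "b \<in> derived s br" "u \<in> U"
      using complement_U unfolding direct_sum_def by (cases v) blast
    show ?thesis
      using phi_eq[OF subspace_scale[OF subspace_derived v(2)] subspace_scale[OF subspace_U v(3)]]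
        phi_eq[OF v(2,3)] v(1)
      by (simp add: scale_right_distrib d.scale d'.scale)
  qed
  ultimately show ?thesis
    by unfold_locales
qed

lemma homogeneous_map_phi: "homogeneous_map (breve_scale s) (breve_grading G) \<delta> (phi s G br U d)"
proof -
  have "phi s G br U d v \<in> breve_grading G (\<delta> + \<alpha>)" if v: "v \<in> breve_grading G \<alpha>" for \<alpha> v
  proof -
    obtain x x' where x: "v = (x, x')" "x \<in> G \<alpha>" "x' \<in> G \<alpha>"
      using v by (auto simp: breve_grading_def)
    \<comment> \<open>An arbitrary \<open>b\<close> would not do: the degree condition on
      \<open>d'\<close> gives information only at homogeneous arguments.\<close>
    obtain b u where b: "b \<in> derived s br" "b \<in> G \<alpha>" "u \<in> U" "x' = b + u"
      using homogeneous_decomposition[OF graded_U complement_U x(3)] .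
    have "d x \<in> G (\<delta> + \<alpha>)" "d' b \<in> G (\<delta> + \<alpha>)"
      using quasi x(2) b(2) unfolding quasi_associated_def homogeneous_map_def by blast+
    then show ?thesis
      using phi_eq[OF b(1,3)] by (simp add: x b(4) breve_grading_def)
  qed
  then show ?thesis
    using linear_phi unfolding homogeneous_map_def by blast
qed

lemma fst_phi: "fst (phi s G br U d v) = d (fst v)"
proof -
  obtain a b u where v: "v = (a, b + u)" "b \<in> derived s br" "u \<in> U"
    using complement_U unfolding direct_sum_def by (cases v) blast
  then show ?thesis using phi_eq by simp
qed

lemma derivation_phi:
  "derivation (breve_scale s) (breve_grading G) (breve_br br) \<delta> (phi s G br U d)"
proof -
  interpret d: Vector_Spaces.linear s s d by (rule linear_d)
  have br: "breve_br br v w = (0, br (fst v) (fst w))" for v w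
    by (cases v; cases w) simp
  \<comment> \<open>A bracket decomposes as itself plus the zero of \<open>U\<close>, so the
    projection leaves it unchanged.\<close>
  have phi: "phi s G br U d (0, br x y) = (0, d' (br x y))" for x y
    using phi_eq[OF br_in_derived[of x y] subspace_0[OF subspace_U], of 0] by (simp add: d.zero)
  show ?thesis
    using homogeneous_map_phi quasi
    by (auto simp: derivation_def br phi fst_phi breve_grading_def quasi_associated_def)
qed

text \<open>The form sees only t-components, and there \<phi>(d) acts as \<open>d\<close>, so the
  two compatibility conditions coincide.\<close>

lemma compatible_phi:
  assumes "compatible G \<omega> \<delta> d"
  shows "compatible (breve_grading G) (breve_form \<omega>) \<delta> (phi s G br U d)"
proof -
  have "breve_form \<omega> v w = \<omega> (fst v) (fst w)" for v w
    by (cases v; cases w) simp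
  then show ?thesis
    using assms by (auto simp: compatible_def fst_phi breve_grading_def)
qed

end

text \<open>This makes \<open>phi_add\<close> and \<open>phi_scale\<close>, which are stated on
  \<open>QDer\<close>, available on the compatible part.\<close>

lemma QDer_omega_subset_QDer: "QDer_omega s G br \<omega> \<subseteq> QDer s G br"
proof -
  interpret F: module "\<lambda>c f x. s c (f x)" by (rule module_fun)
  show ?thesis
    unfolding QDer_omega_def QDer_def End_span_def by (rule F.span_mono) blast
qed

text \<open>Both sides are spans of homogeneous maps and \<phi> is linear on \<open>QDer\<close>, so
  the claim reduces to homogeneous generators.\<close>

lemma phi_QDer_omega:
  assumes U: "graded_subspace s G U" "direct_sum UNIV (derived s br) U"
    and f: "f \<in> QDer_omega s G br \<omega>"
  shows "phi s G br U f
    \<in> Der_omega (breve_scale s) (breve_grading G) (breve_br br) (breve_form \<omega>)"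
proof -
  interpret F: module "\<lambda>c f x. s c (f x)" by (rule module_fun)
  interpret B: vector_space "breve_scale s" by (rule vector_space_breve_scale)
  \<comment> \<open>\<open>End_span\<close> for the extension is the span in this module of maps
    with pointwise operations.\<close>
  interpret E: module "\<lambda>c (f :: 'v \<times> 'v \<Rightarrow> 'v \<times> 'v) v. breve_scale s c (f v)"
    by unfold_locales (auto simp: fun_eq_iff B.scale_right_distrib B.scale_left_distrib)
  let ?Q = "{d. \<exists>\<delta>. quasiderivation s G br \<delta> d \<and> compatible G \<omega> \<delta> d}"
  let ?D = "Der_omega (breve_scale s) (breve_grading G) (breve_br br) (breve_form \<omega>)"
  have D: "?D = E.span {d. \<exists>\<delta>. derivation (breve_scale s) (breve_grading G) (breve_br br) \<delta> d
      \<and> compatible (breve_grading G) (breve_form \<omega>) \<delta> d}"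
    by (simp add: Der_omega_def End_span_def)
  have subU: "subspace U"
    using U by (simp add: graded_subspace_def)
  have gen: "phi s G br U d \<in> ?D" if d: "d \<in> ?Q" for d
  proof -
    obtain \<delta> d' where "quasi_associated s G br \<delta> d d'" "compatible G \<omega> \<delta> d"
      using d unfolding quasiderivation_def by blast
    then show ?thesis
      \<comment> \<open>The image of a generator is a generator of the same degree \<delta>.\<close>
      unfolding D using derivation_phi[OF U] compatible_phi[OF U]
      by (intro E.span_base CollectI exI[of _ \<delta>]) blast
  qed
  have QDer: "F.span ?Q \<subseteq> QDer s G br"
    using QDer_omega_subset_QDer by (simp add: QDer_omega_def End_span_def)
  have "f \<in> F.span ?Q"
    using f by (simp add: QDer_omega_def End_span_def)
  \<comment> \<open>Membership in the span is carried through the induction because additivity of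
    \<phi> requires the partial sum \<open>e\<close> to lie in \<open>QDer\<close>.\<close>
  then have "f \<in> F.span ?Q \<and> phi s G br U f \<in> ?D"
  proof (induction rule: F.span_induct_alt)
    case base
    \<comment> \<open>Scaling the zero map by 0 yields \<phi>(0) = 0 without looking at the choice
      of \<open>d'\<close> in the definition.\<close>
    have "phi s G br U 0 = (\<lambda>v. breve_scale s 0 (phi s G br U 0 v))"
      using phi_scale[OF subU U(2), of 0 0] QDer F.span_zero by (auto simp: zero_fun_def)
    then have "phi s G br U 0 = 0"
      by (simp add: fun_eq_iff)
    then show ?case
      using F.span_zero E.span_zero unfolding D by metis
  next
    case (step c d e)
    have c: "(\<lambda>x. s c (d x)) \<in> F.span ?Q"
      using F.span_scale[OF F.span_base[OF step.hyps]] .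
    have "d \<in> QDer s G br" "(\<lambda>x. s c (d x)) \<in> QDer s G br" "e \<in> QDer s G br"
      using QDer F.span_base[OF step.hyps] c step.IH by blast+
    then have "phi s G br U ((\<lambda>x. s c (d x)) + e) = (\<lambda>v. breve_scale s c (phi s G br U d v)) + phi s G br U e"
      by (simp only: phi_add[OF subU U(2)] phi_scale[OF subU U(2)])
    also have "\<dots> \<in> ?D"
      using gen[OF step.hyps] step.IH unfolding D by (intro E.span_add E.span_scale) auto
    finally show ?case
      using c step.IH F.span_add by blast
  qed
  then show ?thesis ..
qed

end

theorem corollary4p3:
  fixes s :: "'k::field_char_0 \<Rightarrow> 'v::ab_group_add \<Rightarrow> 'v"
    and G :: "bit \<Rightarrow> 'v set"
    and br :: "'v \<Rightarrow> 'v \<Rightarrow> 'v"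
    and \<omega> :: "'v \<Rightarrow> 'v \<Rightarrow> 'k"
    and U :: "'v set"
  assumes "omega_lie_superalgebra s G br \<omega>"
    and "graded_subspace s G U"
    and "direct_sum UNIV (derived s br) U"
  shows "phi s G br U ` QDer_omega s G br \<omega>
           \<subseteq> Der_omega (breve_scale s) (breve_grading G) (breve_br br) (breve_form \<omega>)"
  using omega_lie_superalgebra.phi_QDer_omega[OF assms(1-3)] by blast

end
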